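(* Let $Z, Z_1, Z_2, \ldots$ be independent and identically distributed real random variables with $\mathrm{E}[Z] = 0$ and $\mathrm{Var}[Z] = \mathrm{E}[Z^2] = 1$. For $n \ge 1$ let $U_n = Z_1 + \cdots + Z_n$ and let $S_n = U_n/n^{1/2}$. Let $N$ be a normally distributed random variable with $\mathrm{E}[N] = 0$ and $\mathrm{Var}[N] = 1$. Then $\lim_{n\to\infty} F_{S_n}(t) = F_N(t)$ for all real $t$.
   Context: For a real random variable $X$, $F_X(x) = \Pr[X \le x]$ denotes its distribution function. *)

theory Defs
  imports "HOL-Probability.Probability"
begin

end

theory Submission
  imports Defs
begin

text \<open>The analytic core is the library's \<open>central_limit_theorem_zero_mean\<close>:
  normalized sums of i.i.d. centred square-integrable variables converge weakly to the standard
  normal law. Weak convergence means convergence of distribution functions at continuity points of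
  the limit, and \<open>cdf_std_normal_isCont\<close> makes every real t such a point. It remains to
  identify the law of \<open>N\<close> (\<open>distr_standardized_normal\<close>) and to pass from
  indices starting at 1 to indices starting at 0 while keeping independence
  (\<open>indep_vars_reindex\<close>).\<close>

lemma cdf_std_normal_isCont: "isCont (cdf std_normal_distribution) x"
proof -
  interpret real_distribution std_normal_distribution
    by (rule real_dist_normal_dist)
  \<comment> \<open>A cdf is continuous exactly where the measure has no atom, and a law with a
    Lebesgue density has none.\<close>
  have "emeasure std_normal_distribution {x} = 0"
    by (subst emeasure_density) (auto simp: nn_integral_cmult_indicator)
  then show ?thesis
    by (simp add: isCont_cdf measure_def)
qed

text \<open>Mean and variance of a normal law are its parameters \<mu> and the square of \<sigma>,
  so standardization pins both down; positivity of \<sigma> excludes -1.\<close>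

lemma (in prob_space) distr_standardized_normal:
  assumes N: "distributed M lborel N (normal_density \<mu> \<sigma>)" and "0 < \<sigma>"
    and "expectation N = 0" and "variance N = 1"
  shows "distr M borel N = std_normal_distribution"
proof -
  have "\<mu> = 0"
    using normal_distributed_expectation[OF \<open>0 < \<sigma>\<close> N] assms by simp
  moreover have "\<sigma> = 1"
    using normal_distributed_variance[OF \<open>0 < \<sigma>\<close> N] assms by (simp add: power2_eq_1_iff)
  ultimately have "distr M lborel N = std_normal_distribution"
    using N by (simp add: distributed_distr_eq_density)
  then show ?thesis
    by (simp cong: distr_cong)
qed

lemma (in prob_space) indep_sets_reindex:
  assumes inj: "inj_on f I" and indep: "indep_sets F (f ` I)"
  shows "indep_sets (\<lambda>i. F (f i)) I"
proof (rule indep_setsI)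
  show "F (f i) \<subseteq> events" if "i \<in> I" for i
    using indep that by (auto simp: indep_sets_def)
next
  fix A J assume J: "J \<noteq> {}" "J \<subseteq> I" "finite J" and A: "\<forall>j\<in>J. A j \<in> F (f j)"
  have inj_J: "inj_on f J"
    using inj \<open>J \<subseteq> I\<close> by (rule inj_on_subset)
  define B where "B = A \<circ> the_inv_into J f"
  have B: "B (f j) = A j" if "j \<in> J" for j
    using that inj_J by (simp add: B_def the_inv_into_f_f)
  have "prob (\<Inter>k\<in>f ` J. B k) = (\<Prod>k\<in>f ` J. prob (B k))"
    using J A by (intro indep_setsD[OF indep]) (auto simp: B)
  then show "prob (\<Inter>j\<in>J. A j) = (\<Prod>j\<in>J. prob (A j))"
    by (simp add: prod.reindex[OF inj_J] B cong: prod.cong INF_cong)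
qed

lemma (in prob_space) indep_vars_reindex:
  assumes "inj_on f I" and "indep_vars M' X (f ` I)"
  shows "indep_vars (\<lambda>i. M' (f i)) (\<lambda>i. X (f i)) I"
  using assms indep_sets_reindex[OF assms(1)] by (auto simp: indep_vars_def2)

theorem theorem1:
  fixes M :: "'a measure" and M' :: "'b measure"
    and Z :: "'a \<Rightarrow> real" and Zs :: "nat \<Rightarrow> 'a \<Rightarrow> real"
    and N :: "'b \<Rightarrow> real"
    and U S :: "nat \<Rightarrow> 'a \<Rightarrow> real"
  assumes "prob_space M"
    and indep: "prob_space.indep_vars M (\<lambda>_. borel) (Zs(0 := Z)) UNIV"
    and ident: "\<And>i. i \<ge> 1 \<Longrightarrow> distr M borel (Zs i) = distr M borel Z"
    and "integrable M Z" and "integrable M (\<lambda>\<omega>. (Z \<omega>)\<^sup>2)"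
    and "prob_space.expectation M Z = 0"
    and "prob_space.variance M Z = 1"
    and "prob_space.expectation M (\<lambda>\<omega>. (Z \<omega>)\<^sup>2) = 1"
    and U: "\<And>n \<omega>. n \<ge> 1 \<Longrightarrow> U n \<omega> = (\<Sum>i=1..n. Zs i \<omega>)"
    and S: "\<And>n \<omega>. n \<ge> 1 \<Longrightarrow> S n \<omega> = U n \<omega> / real n powr (1/2)"
    and "prob_space M'"
    and normal: "\<exists>\<mu> \<sigma>. 0 < \<sigma> \<and> distributed M' lborel N (normal_density \<mu> \<sigma>)"
    and "prob_space.expectation M' N = 0"
    and "prob_space.variance M' N = 1"
  shows "\<forall>t::real. (\<lambda>n. cdf (distr M borel (S n)) t) \<longlonglongrightarrow> cdf (distr M' borel N) t"
proof
  fix t :: real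
  interpret prob_space M by fact
  interpret M': prob_space M' by fact
  have N: "distr M' borel N = std_normal_distribution"
    using normal M'.distr_standardized_normal[OF _ _ \<open>M'.expectation N = 0\<close> \<open>M'.variance N = 1\<close>]
    by blast
  \<comment> \<open>The shift matches the library's sums over \<open>i<n\<close>; in the independent
    family, index 0 is occupied by \<open>Z\<close> itself.\<close>
  define X where "X i = Zs (Suc i)" for i
  have Z_rv [measurable]: "Z \<in> borel_measurable M"
    using \<open>integrable M Z\<close> by (rule borel_measurable_integrable)
  have X_indep: "indep_vars (\<lambda>_. borel) X UNIV"
  proof -
    have "indep_vars (\<lambda>_. borel) (Zs(0 := Z)) (range Suc)"
      using indep by (rule indep_vars_subset) simp
    from indep_vars_reindex[OF _ this] show ?thesis
      by (simp add: X_def [abs_def])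
  qed
  then have X_rv [measurable]: "X i \<in> borel_measurable M" for i
    unfolding indep_vars_def2 by simp
  have X_distr: "distr M borel (X i) = distr M borel Z" for i
    using ident[of "Suc i"] by (simp add: X_def)
  \<comment> \<open>Moments depend only on the law, so those of \<open>Z\<close> transfer through
    integrals against the common pushforward.\<close>
  have X_mean: "expectation (X i) = 0" for i
    using integral_distr[OF X_rv[of i], of "\<lambda>x. x"] integral_distr[OF Z_rv, of "\<lambda>x. x"]
      X_distr[of i] \<open>expectation Z = 0\<close> by simp
  have X_square: "integrable M (\<lambda>\<omega>. (X i \<omega>)\<^sup>2)" for i
    using integrable_distr_eq[OF X_rv[of i], of "\<lambda>x. x\<^sup>2"] integrable_distr_eq[OF Z_rv, of "\<lambda>x. x\<^sup>2"]
      X_distr[of i] \<open>integrable M (\<lambda>\<omega>. (Z \<omega>)\<^sup>2)\<close> by simp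
  \<comment> \<open>Written as a square to match the library's variance parameter, here with
    standard deviation 1.\<close>
  have X_var: "variance (X i) = 1\<^sup>2" for i
    using integral_distr[OF X_rv[of i], of "\<lambda>x. x\<^sup>2"] integral_distr[OF Z_rv, of "\<lambda>x. x\<^sup>2"]
      X_distr[of i] X_mean[of i] \<open>expectation (\<lambda>\<omega>. (Z \<omega>)\<^sup>2) = 1\<close> by simp
  have "weak_conv_m (\<lambda>n. distr M borel (\<lambda>\<omega>. (\<Sum>i<n. X i \<omega>) / sqrt (n * 1\<^sup>2)))
      std_normal_distribution"
    using central_limit_theorem_zero_mean[OF X_indep X_mean _ X_square X_var X_distr] by simp
  then have lim: "(\<lambda>n. cdf (distr M borel (\<lambda>\<omega>. (\<Sum>i<n. X i \<omega>) / sqrt n)) t)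
      \<longlonglongrightarrow> cdf (distr M' borel N) t"
    using cdf_std_normal_isCont by (simp add: N weak_conv_m_def weak_conv_def)
  have S_eq: "S n = (\<lambda>\<omega>. (\<Sum>i<n. X i \<omega>) / sqrt n)" if "n \<ge> 1" for n
    using that
    by (auto simp: S U X_def powr_half_sqrt sum.atLeast1_atMost_eq)
  show "(\<lambda>n. cdf (distr M borel (S n)) t) \<longlonglongrightarrow> cdf (distr M' borel N) t"
    \<comment> \<open>\<open>S 0\<close> is unconstrained, so the two sequences are only known to
      agree from n = 1 on.\<close>
    by (rule Lim_transform_eventually[OF lim])
      (auto intro!: eventually_sequentiallyI[of 1] simp: S_eq)
qed

end
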